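(* Let $D$ be any Gauss diagram of a virtual knot $K$. The formula $K\mapsto I(D)\in\mathcal{P}$ defines a complete invariant of virtual knots: the class of $I(D)$ in the Polyak algebra $\mathcal{P}$ depends only on $K$, and two virtual knots with the same image in $\mathcal{P}$ are equal.
   Context: A Gauss diagram is an oriented circle with a finite set of arrows, i.e. ordered pairs (tail, head) of points of the circle, all endpoints being pairwise distinct, each arrow being equipped with a sign $\pm$; Gauss diagrams are considered up to orientation preserving homeomorphism of the circle. Let $\mathcal{D}$ be the set of Gauss diagrams. A virtual knot is presented by a Gauss diagram (each arrow corresponds to a real crossing, is directed from the upper to the lower branch, and its sign is the local writhe; virtual crossings are disregarded), and virtual knots are the equivalence classes of Gauss diagrams under the following moves, counterparts of the Reidemeister moves, and their inverses. Two endpoints are called adjacent if one of the two arcs of the circle between them contains no other endpoints in its interior. (R1) Remove an arrow of any sign whose head and tail are adjacent. (R2) Remove two arrows of opposite signs whose tails are adjacent to each other and whose heads are adjacent to each other. (R3) Suppose there are three pairwise disjoint oriented arcs $e_1,e_2,e_3$ of the circle (in any cyclic order, oriented by the circle) and three positive arrows $a_{12},a_{13},a_{23}$, with $a_{ij}$ having its tail on $e_i$ and head on $e_j$, such that the arcs contain no other endpoints and the order of endpoints along the arcs is: on $e_1$, $a_{12}$ then $a_{13}$; on $e_2$, $a_{12}$ then $a_{23}$; on $e_3$, $a_{13}$ then $a_{23}$. Replace this by the diagram with the same arrows in which the order of the two endpoints is reversed on each of $e_1,e_2,e_3$. An arrow diagram is an oriented circle with finitely many signed (dashed) arrows, i.e.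 the same combinatorial object as a Gauss diagram; $\mathcal{A}$ is the free abelian group generated by arrow diagrams (the "algebra of arrow diagrams"), and $i:\mathbb{Z}[\mathcal{D}]\to\mathcal{A}$ is the isomorphism making all arrows dashed. A subdiagram $D'\subset D$ is obtained by keeping a subset of the arrows of $D$. Define $I:\mathbb{Z}[\mathcal{D}]\to\mathcal{A}$ by linearity and $I(D)=\sum_{D'\subset D}i(D')$ (sum over all subsets of arrows). The Polyak algebra $\mathcal{P}$ is the quotient of $\mathcal{A}$ by the following relations. (1) $A=0$ if $A$ contains an arrow whose head and tail are adjacent. (2) $A+A_1+A_2=0$ if $A$ contains two arrows $\alpha_1,\alpha_2$ of opposite signs with adjacent tails and adjacent heads, where $A_j$ is obtained from $A$ by deleting the arrow other than $\alpha_j$. (3) If $A$ and $A'$ are the two diagrams (before and after) of a move (R3), then $\sum_{S}A_S=\sum_{S}A'_S$, where $S$ runs over the subsets of $\{a_{12},a_{13},a_{23}\}$ with at least two elements and $A_S$, $A'_S$ are obtained from $A$, $A'$ by deleting those of the three arrows which are not in $S$ (all other arrows are kept). *)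

theory Defs
  imports "HOL-Analysis.Analysis" "HOL-Algebra.Free_Abelian_Groups"
begin

section \<open>The oriented circle\<close>

text \<open>The circle is the unit circle of the complex plane, oriented counterclockwise. A homeomorphism
  of it preserves the orientation iff it lifts along \<open>cis\<close> to an increasing homeomorphism of
  the real line.\<close>

definition circle :: "complex set" where
  "circle = sphere 0 1"

definition orientation_preserving_homeo :: "(complex \<Rightarrow> complex) \<Rightarrow> bool" where
  "orientation_preserving_homeo h \<longleftrightarrow>
     (\<exists>h'. homeomorphism circle circle h h') \<and>
     (\<exists>g g' :: real \<Rightarrow> real. homeomorphism UNIV UNIV g g' \<and> strict_mono g \<and>
        (\<forall>t. h (cis t) = cis (g t)))"

text \<open>The open arc running from \<open>p\<close> to \<open>q\<close> along the orientation; it is empty for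
  \<open>p = q\<close>.\<close>

definition open_arc :: "complex \<Rightarrow> complex \<Rightarrow> complex set" where
  "open_arc p q = {z. \<exists>s t u. s < t \<and> t < u \<and> u < s + 2 * pi \<and> p = cis s \<and> z = cis t \<and> q = cis u}"

section \<open>Gauss diagrams\<close>

datatype arrow_sign = Positive | Negative

datatype arrow = Arrow (tail: complex) (head: complex) (sgn_of: arrow_sign)

definition ends :: "arrow \<Rightarrow> complex set" where
  "ends a = {tail a, head a}"

definition endpoints :: "arrow set \<Rightarrow> complex set" where
  "endpoints G = (\<Union>a\<in>G. ends a)"

definition is_diagram :: "arrow set \<Rightarrow> bool" where
  "is_diagram G \<longleftrightarrow> finite G \<and> (\<forall>a\<in>G. ends a \<subseteq> circle \<and> tail a \<noteq> head a) \<and>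
     (\<forall>a\<in>G. \<forall>b\<in>G. a \<noteq> b \<longrightarrow> ends a \<inter> ends b = {})"

definition map_arrow :: "(complex \<Rightarrow> complex) \<Rightarrow> arrow \<Rightarrow> arrow" where
  "map_arrow h a = Arrow (h (tail a)) (h (head a)) (sgn_of a)"

definition same_diagram :: "arrow set \<Rightarrow> arrow set \<Rightarrow> bool" where
  "same_diagram G H \<longleftrightarrow> is_diagram G \<and> is_diagram H \<and>
     (\<exists>h. orientation_preserving_homeo h \<and> H = map_arrow h ` G)"

lemma is_diagram_subset: "is_diagram G \<Longrightarrow> H \<subseteq> G \<Longrightarrow> is_diagram H"
  unfolding is_diagram_def by (meson finite_subset subsetD)

lemma orientation_preserving_homeo_id: "orientation_preserving_homeo (\<lambda>z. z)"
  unfolding orientation_preserving_homeo_def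
  by (intro conjI exI[of _ "\<lambda>z. z"]) (auto simp: homeomorphism_ident strict_mono_def)

lemma orientation_preserving_homeo_compose:
  assumes "orientation_preserving_homeo h" "orientation_preserving_homeo k"
  shows "orientation_preserving_homeo (k \<circ> h)"
proof -
  from assms(1) obtain h' g g' where h: "homeomorphism circle circle h h'"
    "homeomorphism UNIV UNIV g g'" "strict_mono (g :: real \<Rightarrow> real)" "\<forall>t. h (cis t) = cis (g t)"
    unfolding orientation_preserving_homeo_def by blast
  from assms(2) obtain k' f f' where k: "homeomorphism circle circle k k'"
    "homeomorphism UNIV UNIV f f'" "strict_mono (f :: real \<Rightarrow> real)" "\<forall>t. k (cis t) = cis (f t)"
    unfolding orientation_preserving_homeo_def by blast
  show ?thesis
    unfolding orientation_preserving_homeo_def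
  proof (intro conjI exI)
    show "homeomorphism circle circle (k \<circ> h) (h' \<circ> k')"
      using h k by (blast intro: homeomorphism_compose)
    show "homeomorphism UNIV UNIV (f \<circ> g) (g' \<circ> f')"
      using h k by (blast intro: homeomorphism_compose)
    show "strict_mono (f \<circ> g)" using h k by (simp add: strict_mono_def)
    show "\<forall>t. (k \<circ> h) (cis t) = cis ((f \<circ> g) t)" using h k by simp
  qed
qed

lemma orientation_preserving_homeo_inverse:
  assumes "orientation_preserving_homeo h"
  shows "\<exists>h'. orientation_preserving_homeo h' \<and> (\<forall>z\<in>circle. h' (h z) = z)"
proof -
  from assms obtain h' g g' where h: "homeomorphism circle circle h h'"
    "homeomorphism UNIV UNIV g g'" "strict_mono (g :: real \<Rightarrow> real)" "\<And>t. h (cis t) = cis (g t)"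
    unfolding orientation_preserving_homeo_def by blast
  have gg: "g (g' t) = t" for t
    using h(2) by (simp add: homeomorphism_def)
  have "orientation_preserving_homeo h'"
    unfolding orientation_preserving_homeo_def
  proof (intro conjI exI)
    show "homeomorphism circle circle h' h" using h(1) by (rule homeomorphism_symD)
    show "homeomorphism UNIV UNIV g' g" using h(2) by (rule homeomorphism_symD)
    show "strict_mono g'"
      by (metis gg h(3) strict_monoI strict_mono_less)
    have "h' (h (cis (g' t))) = cis (g' t)" for t
      using h(1) by (simp add: homeomorphism_def circle_def)
    then show "\<forall>t. h' (cis t) = cis (g' t)" by (simp add: h(4) gg)
  qed
  moreover have "h' (h z) = z" if "z \<in> circle" for z
    using h(1) that by (simp add: homeomorphism_def)
  ultimately show ?thesis by blast
qed

lemma map_arrow_compose: "map_arrow k ` map_arrow h ` G = map_arrow (k \<circ> h) ` G"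
  by (simp add: image_image map_arrow_def)

lemma same_diagram_refl: "is_diagram G \<Longrightarrow> same_diagram G G"
  unfolding same_diagram_def
  by (auto intro!: exI[of _ "\<lambda>z. z"] orientation_preserving_homeo_id simp: map_arrow_def)

lemma same_diagram_sym: "same_diagram H G" if "same_diagram G H"
proof -
  from that obtain h where h: "is_diagram G" "is_diagram H" "orientation_preserving_homeo h"
    "H = map_arrow h ` G" unfolding same_diagram_def by blast
  obtain k where k: "orientation_preserving_homeo k" "\<And>z. z \<in> circle \<Longrightarrow> k (h z) = z"
    using orientation_preserving_homeo_inverse[OF h(3)] by blast
  have "map_arrow k ` map_arrow h ` G = (\<lambda>a. a) ` G"
    unfolding map_arrow_compose
  proof (rule image_cong[OF refl])
    fix a assume "a \<in> G"
    then have "tail a \<in> circle" "head a \<in> circle"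
      using h(1) by (auto simp: is_diagram_def ends_def)
    then show "map_arrow (k \<circ> h) a = a" by (simp add: map_arrow_def k(2))
  qed
  then show ?thesis using h k(1) unfolding same_diagram_def by auto
qed

lemma same_diagram_trans: "same_diagram G H \<Longrightarrow> same_diagram H K \<Longrightarrow> same_diagram G K"
  unfolding same_diagram_def
  by (metis map_arrow_compose orientation_preserving_homeo_compose)

quotient_type gauss_diagram = "arrow set" / partial: same_diagram
  morphisms rep_gauss_diagram gauss_diagram_of
proof (rule part_equivpI)
  show "\<exists>G. same_diagram G G"
    by (rule exI[of _ "{}"]) (simp add: same_diagram_refl is_diagram_def)
  show "symp same_diagram" by (rule sympI) (rule same_diagram_sym)
  show "transp same_diagram" by (rule transpI) (rule same_diagram_trans)
qed

section \<open>Reidemeister moves and virtual knots\<close>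

definition adjacent :: "arrow set \<Rightarrow> complex \<Rightarrow> complex \<Rightarrow> bool" where
  "adjacent G p q \<longleftrightarrow> p \<in> endpoints G \<and> q \<in> endpoints G \<and> p \<noteq> q \<and>
     (open_arc p q \<inter> endpoints G = {} \<or> open_arc q p \<inter> endpoints G = {})"

definition R1_config :: "arrow set \<Rightarrow> arrow \<Rightarrow> bool" where
  "R1_config G a \<longleftrightarrow> is_diagram G \<and> a \<in> G \<and> adjacent G (tail a) (head a)"

definition R2_config :: "arrow set \<Rightarrow> arrow \<Rightarrow> arrow \<Rightarrow> bool" where
  "R2_config G a b \<longleftrightarrow> is_diagram G \<and> a \<in> G \<and> b \<in> G \<and> sgn_of a \<noteq> sgn_of b \<and>
     adjacent G (tail a) (tail b) \<and> adjacent G (head a) (head b)"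

text \<open>\<open>arc_meets G l r x y\<close>: the endpoints of \<open>G\<close> lying on the oriented arc from
  \<open>l\<close> to \<open>r\<close> are exactly \<open>x\<close> and, after it, \<open>y\<close>.\<close>

definition arc_meets :: "arrow set \<Rightarrow> complex \<Rightarrow> complex \<Rightarrow> complex \<Rightarrow> complex \<Rightarrow> bool" where
  "arc_meets G l r x y \<longleftrightarrow>
     x \<in> open_arc l r \<and> y \<in> open_arc x r \<and> open_arc l r \<inter> endpoints G = {x, y}"

definition R3_config :: "arrow set \<Rightarrow> arrow \<Rightarrow> arrow \<Rightarrow> arrow \<Rightarrow> bool" where
  "R3_config G a12 a13 a23 \<longleftrightarrow> is_diagram G \<and> {a12, a13, a23} \<subseteq> G \<and>
     sgn_of a12 = Positive \<and> sgn_of a13 = Positive \<and> sgn_of a23 = Positive \<and>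
     (\<exists>l1 r1 l2 r2 l3 r3.
        open_arc l1 r1 \<inter> open_arc l2 r2 = {} \<and>
        open_arc l1 r1 \<inter> open_arc l3 r3 = {} \<and>
        open_arc l2 r2 \<inter> open_arc l3 r3 = {} \<and>
        arc_meets G l1 r1 (tail a12) (tail a13) \<and>
        arc_meets G l2 r2 (head a12) (tail a23) \<and>
        arc_meets G l3 r3 (head a13) (head a23))"

text \<open>Reversing the order of the two endpoints on each of the three arcs means exchanging their
  positions; all other endpoints are left fixed.\<close>

definition R3_swap :: "arrow \<Rightarrow> arrow \<Rightarrow> arrow \<Rightarrow> complex \<Rightarrow> complex" where
  "R3_swap a12 a13 a23 =
     Transposition.transpose (tail a12) (tail a13) \<circ>
     Transposition.transpose (head a12) (tail a23) \<circ>
     Transposition.transpose (head a13) (head a23)"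

inductive reidemeister_move :: "gauss_diagram \<Rightarrow> gauss_diagram \<Rightarrow> bool" where
  R1: "R1_config G a \<Longrightarrow>
       reidemeister_move (gauss_diagram_of G) (gauss_diagram_of (G - {a}))"
| R2: "R2_config G a b \<Longrightarrow>
       reidemeister_move (gauss_diagram_of G) (gauss_diagram_of (G - {a, b}))"
| R3: "R3_config G a12 a13 a23 \<Longrightarrow>
       reidemeister_move (gauss_diagram_of G)
         (gauss_diagram_of (map_arrow (R3_swap a12 a13 a23) ` G))"

quotient_type virtual_knot = gauss_diagram / "equivclp reidemeister_move"
  morphisms rep_virtual_knot virtual_knot_of
  by (rule equivp_evquivclp)

section \<open>Arrow diagrams and the map I\<close>

text \<open>Arrow diagrams are the same combinatorial objects as Gauss diagrams, so both
  \<open>\<int>[\<D>]\<close> and \<open>\<A>\<close> are \<open>gauss_diagram \<Rightarrow>\<^sub>0 int\<close>,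
  and the isomorphism making all arrows dashed is the identity.\<close>

type_synonym arrow_diagram = gauss_diagram

lift_definition subdiagram_sum :: "gauss_diagram \<Rightarrow> arrow_diagram \<Rightarrow>\<^sub>0 int" is
  "\<lambda>G. \<Sum>H\<in>Pow G. frag_of (gauss_diagram_of H)"
proof -
  fix G K assume "same_diagram G K"
  then obtain h where h: "is_diagram G" "is_diagram K" "orientation_preserving_homeo h"
    "K = map_arrow h ` G" unfolding same_diagram_def by blast
  obtain k where k: "\<And>z. z \<in> circle \<Longrightarrow> k (h z) = z"
    using orientation_preserving_homeo_inverse[OF h(3)] by blast
  have "inj_on (map_arrow h) G"
  proof (rule inj_on_inverseI)
    fix a assume "a \<in> G"
    then have "tail a \<in> circle" "head a \<in> circle"
      using h(1) by (auto simp: is_diagram_def ends_def)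
    then show "map_arrow k (map_arrow h a) = a" by (simp add: map_arrow_def k)
  qed
  then have inj: "inj_on ((`) (map_arrow h)) (Pow G)"
    by (rule inj_on_image_Pow)
  have eq: "gauss_diagram_of (map_arrow h ` H) = gauss_diagram_of H" if "H \<subseteq> G" for H
  proof -
    have "map_arrow h ` H \<subseteq> K" using that h(4) by blast
    then have "same_diagram H (map_arrow h ` H)"
      unfolding same_diagram_def using that h is_diagram_subset by blast
    then show ?thesis
      using Quotient3_rel_abs[OF Quotient3_gauss_diagram] by metis
  qed
  have "(\<Sum>H\<in>Pow K. frag_of (gauss_diagram_of H)) =
        (\<Sum>H\<in>(`) (map_arrow h) ` Pow G. frag_of (gauss_diagram_of H))"
    by (simp add: h(4) image_Pow_surj)
  also have "\<dots> = (\<Sum>H\<in>Pow G. frag_of (gauss_diagram_of (map_arrow h ` H)))"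
    by (simp add: sum.reindex[OF inj])
  also have "\<dots> = (\<Sum>H\<in>Pow G. frag_of (gauss_diagram_of H))"
    by (rule sum.cong) (auto simp: eq)
  finally show "(\<Sum>H\<in>Pow G. frag_of (gauss_diagram_of H)) =
    (\<Sum>H\<in>Pow K. frag_of (gauss_diagram_of H))" by simp
qed

definition I_map :: "(gauss_diagram \<Rightarrow>\<^sub>0 int) \<Rightarrow> (arrow_diagram \<Rightarrow>\<^sub>0 int)" where
  "I_map = frag_extend subdiagram_sum"

section \<open>The Polyak algebra\<close>

inductive_set polyak_relators :: "(arrow_diagram \<Rightarrow>\<^sub>0 int) set" where
  rel1: "R1_config A a \<Longrightarrow> frag_of (gauss_diagram_of A) \<in> polyak_relators"
| rel2: "R2_config A a b \<Longrightarrow>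
         frag_of (gauss_diagram_of A) + frag_of (gauss_diagram_of (A - {b}))
           + frag_of (gauss_diagram_of (A - {a})) \<in> polyak_relators"
| rel3: "\<lbrakk>R3_config A a12 a13 a23; T = {a12, a13, a23}\<rbrakk> \<Longrightarrow>
         (\<Sum>S | S \<subseteq> T \<and> 2 \<le> card S. frag_of (gauss_diagram_of (A - (T - S))))
         - (\<Sum>S | S \<subseteq> T \<and> 2 \<le> card S.
              frag_of (gauss_diagram_of (map_arrow (R3_swap a12 a13 a23) ` (A - (T - S)))))
         \<in> polyak_relators"

abbreviation arrow_diagram_group :: "(arrow_diagram \<Rightarrow>\<^sub>0 int) monoid" where
  "arrow_diagram_group \<equiv> free_Abelian_group UNIV"

definition polyak_relations :: "(arrow_diagram \<Rightarrow>\<^sub>0 int) set" where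
  "polyak_relations = generate arrow_diagram_group polyak_relators"

definition polyak_algebra :: "(arrow_diagram \<Rightarrow>\<^sub>0 int) set monoid" where
  "polyak_algebra = arrow_diagram_group Mod polyak_relations"

definition polyak_class :: "(arrow_diagram \<Rightarrow>\<^sub>0 int) \<Rightarrow> (arrow_diagram \<Rightarrow>\<^sub>0 int) set" where
  "polyak_class x = polyak_relations #>\<^bsub>arrow_diagram_group\<^esub> x"

end

theory Submission
  imports Defs
begin

text \<open>For each move, the subdiagrams of \<open>D\<close> and of \<open>D'\<close> grouped by their arrows outside the move
  contribute to \<open>I(D) - I(D')\<close> exactly one relator of the Polyak algebra per group. Conversely,
  sending an arrow diagram \<open>A\<close> to the alternating sum \<open>\<Sum> (-1)^card (A - H) [H]\<close> over \<open>H \<subseteq> A\<close>,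
  where \<open>[H]\<close> is the virtual knot of \<open>H\<close>, kills all relators and, by Moebius inversion,
  maps \<open>I(D)\<close> to \<open>[D]\<close>; hence the class of \<open>I(D)\<close> determines the knot.\<close>

section \<open>Moving a point inside an arc\<close>

text \<open>The third relation does not match the sum over subdiagrams literally: fixing the arrows
  outside the move leaves all eight subsets of the three arrows, while the relation keeps only those
  with at least two elements. The missing terms cancel because with at most one of the three arrows
  the exchange of endpoints does not change the diagram up to homeomorphism. Since
  \<open>R3_swap\<close> is a mere permutation of points, a genuine homeomorphism with the same
  effect has to be built; the maps of the line constructed below serve this end. The same
  cancellation is needed for the converse: only the full sum over the subsets \<open>S\<close> of
  \<open>T\<close> collapses, leaving terms \<open>H \<union> T\<close> in which all three arrows
  are present and the move applies. The values of the inverse map lie in the free abelian group on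
  knots, where signs make sense and a generator still determines its knot.\<close>

lemma homeomorphism_strict_mono_surj:
  fixes g :: "real \<Rightarrow> real"
  assumes "strict_mono g" "surj g"
  shows "homeomorphism UNIV UNIV g (inv_into UNIV g)"
proof -
  have inj: "inj g" by (rule strict_mono_imp_inj_on[OF assms(1)])
  have "inv_into UNIV g x \<le> inv_into UNIV g y" if "x \<le> y" for x y
    by (metis assms strict_mono_less_eq surj_f_inv_f that)
  moreover have "range (inv_into UNIV g) = UNIV"
    using inj by (rule inj_imp_surj_inv)
  \<comment> \<open>A monotone map onto the whole line has no jumps; the argument serves the inverse
    here and \<open>g\<close> itself below.\<close>
  ultimately have "continuous_on UNIV (inv_into UNIV g)"
    by (intro continuous_onI_mono) auto
  moreover have "continuous_on UNIV g"
    using assms by (intro continuous_onI_mono) (auto dest: strict_mono_mono monoD)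
  ultimately show ?thesis
    using assms inj by (intro homeomorphismI) (auto simp: surj_f_inv_f)
qed

section \<open>Descent of periodic maps of the line to the circle\<close>

lemma periodic_int:
  fixes g :: "real \<Rightarrow> real"
  assumes "\<And>t. g (t + 2 * pi) = g t + 2 * pi"
  shows "g (t + 2 * pi * of_int n) = g t + 2 * pi * of_int n"
proof (induction n rule: int_induct[of _ 0])
  case base show ?case by simp
next
  case (step1 i)
  have "g (t + 2 * pi * of_int (i + 1)) = g ((t + 2 * pi * of_int i) + 2 * pi)"
    by (simp add: algebra_simps)
  also have "\<dots> = g t + 2 * pi * of_int i + 2 * pi" using assms step1.IH by simp
  finally show ?case by (simp add: algebra_simps)
next
  case (step2 i)
  have "g (t + 2 * pi * of_int i) = g ((t + 2 * pi * of_int (i - 1)) + 2 * pi)"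
    by (simp add: algebra_simps)
  also have "\<dots> = g (t + 2 * pi * of_int (i - 1)) + 2 * pi" using assms by simp
  finally show ?case using step2.IH by (simp add: algebra_simps)
qed

lemma cis_eq_cis_iff: "cis s = cis t \<longleftrightarrow> (\<exists>n::int. s = t + 2 * pi * of_int n)"
proof -
  have "cis s = cis t \<longleftrightarrow> sin s = sin t \<and> cos s = cos t"
    by (auto simp: complex_eq_iff)
  also have "\<dots> \<longleftrightarrow> (\<exists>n::int. s = t + 2 * pi * of_int n)"
    by (subst sin_cos_eq_iff) (auto simp: mult.commute)
  finally show ?thesis .
qed

lemma circle_eq_range_cis: "circle = range cis"
proof -
  have "z \<in> range cis" if "norm z = 1" for z
    using cis_Arg[of z] that by (metis norm_zero rangeI sgn_eq div_by_1 of_real_1 zero_neq_one)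
  then show ?thesis by (auto simp: circle_def)
qed

text \<open>Commuting with translation by \<open>2 * pi\<close> makes \<open>cis (g t)\<close>
  depend only on \<open>cis t\<close>, and the inverse of \<open>g\<close> inherits this property.
  The work lies in the continuity of the descended map.\<close>

lemma orientation_preserving_homeo_lift:
  fixes g :: "real \<Rightarrow> real"
  assumes mono: "strict_mono g" and surj: "surj g"
    and periodic: "\<And>t. g (t + 2 * pi) = g t + 2 * pi"
  obtains h where "orientation_preserving_homeo h" "\<And>t. h (cis t) = cis (g t)"
proof -
  define lower where "lower g z = cis (g (Arg z))" for g :: "real \<Rightarrow> real" and z
  \<comment> \<open>Stated for every nonzero \<open>z\<close>, not only on the circle, because
    continuity will be glued over open subsets of the plane; stated for every periodic
    \<open>g\<close>, because the inverse needs it too.\<close>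
  have lower_cis: "lower g z = cis (g t)"
    if "\<And>t. g (t + 2 * pi) = g t + 2 * pi" "z \<noteq> 0" "sgn z = cis t" for g z t
  proof -
    have "cis (Arg z) = cis t" using cis_Arg[OF that(2)] that(3) by simp
    then obtain n :: int where n: "Arg z = t + 2 * pi * of_int n"
      unfolding cis_eq_cis_iff by blast
    have "cis (g t + 2 * pi * of_int n) = cis (g t)" unfolding cis_eq_cis_iff by blast
    then show ?thesis
      unfolding lower_def n periodic_int[of g, OF that(1)] .
  qed
  have cont: "continuous_on circle (lower g)"
    if p: "\<And>t. g (t + 2 * pi) = g t + 2 * pi" and c: "continuous_on UNIV g" for g
  proof -
    have gc: "continuous_on A (\<lambda>z. cis (g (k z)))" if "continuous_on A k" for A and k :: "complex \<Rightarrow> real"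
    proof -
      have "continuous_on A (\<lambda>z. g (k z))"
        using continuous_on_compose2[OF c that] by simp
      then show ?thesis by (intro continuous_intros)
    qed
    have 1: "continuous_on (- \<real>\<^sub>\<le>\<^sub>0) (lower g)"
      unfolding lower_def by (intro gc continuous_on_Arg)
    \<comment> \<open>\<open>Arg\<close> jumps along the negative real axis, the branch \<open>Arg (- z) + pi\<close> along the positive one.\<close>
    have "continuous_on (- \<real>\<^sub>\<ge>\<^sub>0) (\<lambda>z. cis (g (Arg (- z) + pi)))"
      by (intro gc continuous_intros)
        (auto simp: complex_nonneg_Reals_iff complex_nonpos_Reals_iff)
    moreover have "cis (g (Arg (- z) + pi)) = lower g z" if "z \<in> - \<real>\<^sub>\<ge>\<^sub>0" for z
    proof (rule lower_cis[symmetric])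
      show "z \<noteq> 0" using that by auto
      then have "cis (Arg (- z)) = - sgn z" by (simp add: cis_Arg sgn_minus)
      then show "sgn z = cis (Arg (- z) + pi)" by (simp flip: cis_mult)
      show "g (t + 2 * pi) = g t + 2 * pi" for t by (rule p)
    qed
    ultimately have 2: "continuous_on (- \<real>\<^sub>\<ge>\<^sub>0) (lower g)"
      by (rule continuous_on_eq)
    \<comment> \<open>The two closed half-axes meet only in 0, so the two slit planes cover the
      circle.\<close>
    have "continuous_on (- \<real>\<^sub>\<le>\<^sub>0 \<union> - \<real>\<^sub>\<ge>\<^sub>0) (lower g)"
      using 1 2 by (intro continuous_on_open_Un) auto
    then show ?thesis
      by (rule continuous_on_subset)
        (auto simp: circle_def complex_nonneg_Reals_iff complex_nonpos_Reals_iff complex_eq_iff cmod_def)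
  qed
  note hom = homeomorphism_strict_mono_surj[OF mono surj]
  have inv_g: "g (inv_into UNIV g t) = t" "inv_into UNIV g (g t) = t" for t
    using hom by (auto simp: homeomorphism_def)
  have inv_periodic: "inv_into UNIV g (t + 2 * pi) = inv_into UNIV g t + 2 * pi" for t
    by (metis inv_g periodic)
  have on_circle: "lower g (cis t) = cis (g t)" "lower (inv_into UNIV g) (cis t) = cis (inv_into UNIV g t)" for t
    by (rule lower_cis; simp add: periodic inv_periodic)+
  have "homeomorphism circle circle (lower g) (lower (inv_into UNIV g))"
  proof (rule homeomorphismI)
    show "continuous_on circle (lower g)" "continuous_on circle (lower (inv_into UNIV g))"
      using hom by (auto intro!: cont periodic inv_periodic simp: homeomorphism_def)
  qed (auto simp: circle_eq_range_cis on_circle inv_g)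
  then have "orientation_preserving_homeo (lower g)"
    unfolding orientation_preserving_homeo_def using hom mono on_circle(1) by blast
  then show thesis using that on_circle(1) by blast
qed

text \<open>For \<open>x\<close> and \<open>y\<close> strictly between \<open>a\<close> and
  \<open>b\<close>, this is the piecewise linear homeomorphism of the line with support in the
  interval from \<open>a\<close> to \<open>b\<close> and breakpoint \<open>x\<close>, which it
  carries to \<open>y\<close>. Each piece is anchored at an end of the interval.\<close>

definition bend :: "real \<Rightarrow> real \<Rightarrow> real \<Rightarrow> real \<Rightarrow> real \<Rightarrow> real" where
  "bend a b x y t =
     (if t \<le> a \<or> b \<le> t then t
      else if t \<le> x then a + (t - a) * ((y - a) / (x - a))
      else b - (b - t) * ((b - y) / (b - x)))"

text \<open>Exchanging \<open>x\<close> and \<open>y\<close> inverts both slopes, and the image of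
  \<open>t\<close> lies on the same side of \<open>y\<close> as \<open>t\<close> does of
  \<open>x\<close>, so the matching pieces are composed.\<close>

lemma bend_inverse:
  assumes "a < x" "x < b" "a < y" "y < b"
  shows "bend a b y x (bend a b x y t) = t"
proof (cases "t \<le> a \<or> b \<le> t")
  case True then show ?thesis by (simp add: bend_def)
next
  case outer: False
  show ?thesis
  proof (cases "t \<le> x")
    case True
    let ?s = "a + (t - a) * ((y - a) / (x - a))"
    have "(t - a) * ((y - a) / (x - a)) > 0" using outer assms by simp
    moreover have "(t - a) * ((y - a) / (x - a)) \<le> (x - a) * ((y - a) / (x - a))"
      using True assms by (intro mult_right_mono) auto
    ultimately have "a < ?s" "?s \<le> y" using assms by auto
    then show ?thesis using True outer assms by (simp add: bend_def)
  next
    case False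
    let ?s = "b - (b - t) * ((b - y) / (b - x))"
    have "(b - t) * ((b - y) / (b - x)) > 0" using outer assms by simp
    moreover have "(b - t) * ((b - y) / (b - x)) < (b - x) * ((b - y) / (b - x))"
      using False assms by (intro mult_strict_right_mono) auto
    ultimately have "?s < b" "y < ?s" using assms by auto
    then show ?thesis using False outer assms by (simp add: bend_def)
  qed
qed

text \<open>A value outside the interval would be fixed by the inverse and hence equal to
  \<open>t\<close>, which lies inside.\<close>

lemma bend_bounds:
  assumes "a < x" "x < b" "a < y" "y < b" "a < t" "t < b"
  shows "a < bend a b x y t" "bend a b x y t < b"
proof -
  have "bend a b y x (bend a b x y t) = t" using assms by (simp add: bend_inverse)
  then show "a < bend a b x y t" "bend a b x y t < b"
    using assms by (metis bend_def not_le)+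
qed

lemma strict_mono_bend:
  assumes "a < x" "x < b" "a < y" "y < b"
  shows "strict_mono (bend a b x y)"
proof (rule strict_monoI)
  fix s t :: real assume "s < t"
  consider "s \<le> a" | "b \<le> t" | "a < s" "t \<le> x" "t < b" | "a < s" "s \<le> x" "x < t" "t < b"
    | "x < s" "t < b" using \<open>s < t\<close> by linarith
  then show "bend a b x y s < bend a b x y t"
  proof cases
    case 1
    then show ?thesis
      using bend_bounds[OF assms, of t] \<open>s < t\<close> by (cases "t \<le> a \<or> b \<le> t") (auto simp: bend_def)
  next
    case 2
    then show ?thesis
      using bend_bounds[OF assms, of s] \<open>s < t\<close> by (cases "s \<le> a \<or> b \<le> s") (auto simp: bend_def)
  next
    case 3
    then have "(s - a) * ((y - a) / (x - a)) < (t - a) * ((y - a) / (x - a))"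
      using \<open>s < t\<close> assms by (intro mult_strict_right_mono) auto
    then show ?thesis using 3 assms \<open>s < t\<close> by (simp add: bend_def)
  next
    \<comment> \<open>The breakpoint lies between the two arguments, so both values are compared
      with \<open>y\<close>.\<close>
    case 4
    then have "(s - a) * ((y - a) / (x - a)) \<le> (x - a) * ((y - a) / (x - a))"
      using assms by (intro mult_right_mono) auto
    moreover have "(b - t) * ((b - y) / (b - x)) < (b - x) * ((b - y) / (b - x))"
      using 4 assms by (intro mult_strict_right_mono) auto
    ultimately show ?thesis using 4 assms by (simp add: bend_def)
  next
    case 5
    then have "(b - t) * ((b - y) / (b - x)) < (b - s) * ((b - y) / (b - x))"
      using \<open>s < t\<close> assms by (intro mult_strict_right_mono) auto
    then show ?thesis using 5 assms \<open>s < t\<close> by (simp add: bend_def)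
  qed
qed

text \<open>The restriction of \<open>f\<close> to one period is copied to all its translates. Since
  it maps the period into itself, values from different translates keep their order;
  \<open>f'\<close> supplies preimages within the period.\<close>

lemma periodic_extension:
  fixes f f' :: "real \<Rightarrow> real" and a :: real
  assumes mono: "strict_mono f"
    and f: "\<And>t. t \<in> {a..<a + 2 * pi} \<Longrightarrow> f t \<in> {a..<a + 2 * pi}"
    and f': "\<And>t. t \<in> {a..<a + 2 * pi} \<Longrightarrow> f' t \<in> {a..<a + 2 * pi} \<and> f (f' t) = t"
  obtains g where "strict_mono g" "surj g" "\<And>t. g (t + 2 * pi) = g t + 2 * pi"
    "\<And>t. t \<in> {a..<a + 2 * pi} \<Longrightarrow> g t = f t"
proof -
  \<comment> \<open>The multiple of \<open>2 * pi\<close> whose subtraction brings \<open>t\<close>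
    into the chosen period.\<close>
  define k where "k t = 2 * pi * of_int \<lfloor>(t - a) / (2 * pi)\<rfloor>" for t
  define g where "g t = f (t - k t) + k t" for t
  have k_bounds: "t - k t \<in> {a..<a + 2 * pi}" for t
  proof -
    define n where "n = \<lfloor>(t - a) / (2 * pi)\<rfloor>"
    have "of_int n \<le> (t - a) / (2 * pi)" "(t - a) / (2 * pi) < of_int n + 1"
      unfolding n_def by linarith+
    then show ?thesis
      unfolding k_def n_def[symmetric]
      by (simp add: pos_le_divide_eq pos_divide_less_eq algebra_simps)
  qed
  have k_eq: "k (t + 2 * pi * of_int n) = 2 * pi * of_int n" if "t \<in> {a..<a + 2 * pi}" for t n
  proof -
    have "\<lfloor>(t + 2 * pi * of_int n - a) / (2 * pi)\<rfloor> = n"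
      using that by (intro floor_unique) (simp_all add: field_simps)
    then show ?thesis by (simp add: k_def)
  qed
  show thesis
  proof
    show "strict_mono g"
    proof (rule strict_monoI)
      fix s t :: real assume "s < t"
      then have "\<lfloor>(s - a) / (2 * pi)\<rfloor> \<le> \<lfloor>(t - a) / (2 * pi)\<rfloor>"
        by (intro floor_mono divide_right_mono) auto
      then consider "k s = k t" | "\<lfloor>(s - a) / (2 * pi)\<rfloor> + 1 \<le> \<lfloor>(t - a) / (2 * pi)\<rfloor>"
        unfolding k_def by force
      then show "g s < g t"
      proof cases
        case 1 then show ?thesis using \<open>s < t\<close> mono by (simp add: g_def strict_monoD)
      next
        case 2
        then have "of_int (\<lfloor>(s - a) / (2 * pi)\<rfloor> + 1) \<le> (of_int \<lfloor>(t - a) / (2 * pi)\<rfloor> :: real)"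
          by (simp only: of_int_le_iff)
        then have "2 * pi * of_int (\<lfloor>(s - a) / (2 * pi)\<rfloor> + 1) \<le> 2 * pi * of_int \<lfloor>(t - a) / (2 * pi)\<rfloor>"
          by (intro mult_left_mono) auto
        then have "k s + 2 * pi \<le> k t" by (simp add: k_def algebra_simps)
        then show ?thesis using f[OF k_bounds[of s]] f[OF k_bounds[of t]] by (simp add: g_def)
      qed
    qed
    show "surj g"
    proof (rule surjI)
      fix t
      have "k (f' (t - k t) + k t) = k t"
        using k_eq f'[OF k_bounds[of t]] unfolding k_def[of t] by blast
      then show "g (f' (t - k t) + k t) = t"
        using f'[OF k_bounds[of t]] by (simp add: g_def)
    qed
    show "g (t + 2 * pi) = g t + 2 * pi" for t
    proof -
      have "(t + 2 * pi - a) / (2 * pi) = (t - a) / (2 * pi) + 1" by (simp add: field_simps)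
      then have "k (t + 2 * pi) = k t + 2 * pi" by (simp add: k_def algebra_simps)
      then show ?thesis by (simp add: g_def)
    qed
    show "g t = f t" if "t \<in> {a..<a + 2 * pi}" for t
      using k_eq[OF that, of 0] by (simp add: g_def)
  qed
qed

section \<open>Arcs of the circle and motions inside them\<close>

lemma open_arc_eq_image_cis:
  assumes "open_arc l r \<noteq> {}"
  obtains a b where "a < b" "b < a + 2 * pi" "open_arc l r = cis ` {a<..<b}"
proof -
  obtain a t b where "a < t" "t < b" "b < a + 2 * pi" "l = cis a" "r = cis b"
    using assms unfolding open_arc_def by blast
  then have ab: "a < b" "b < a + 2 * pi" "l = cis a" "r = cis b" by simp_all
  have "z \<in> cis ` {a<..<b}" if z: "z \<in> open_arc l r" for z
  proof -
    obtain s t u where stu: "s < t" "t < u" "u < s + 2 * pi" "l = cis s" "z = cis t" "r = cis u"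
      using z unfolding open_arc_def by blast
    obtain n :: int where n: "s = a + 2 * pi * of_int n"
      using ab(3) stu(4) by (metis cis_eq_cis_iff)
    obtain m :: int where m: "u = b + 2 * pi * of_int m"
      using ab(4) stu(6) by (metis cis_eq_cis_iff)
    \<comment> \<open>The lifts in \<open>open_arc\<close> may vary with the point. Both pairs of
      lifts of the end points are at a distance strictly between 0 and \<open>2 * pi\<close>, so
      they are shifted by the same multiple.\<close>
    have "2 * pi * of_int m < 2 * pi * (of_int n + 1)" "2 * pi * of_int n < 2 * pi * (of_int m + 1)"
      using ab(1,2) stu(1-3) n m by (auto simp: algebra_simps)
    then have "m = n" by simp
    then have "t - 2 * pi * of_int n \<in> {a<..<b}" using stu n m by auto
    moreover have "z = cis (t - 2 * pi * of_int n)"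
      unfolding stu(5) cis_eq_cis_iff by (rule exI[of _ n]) simp
    ultimately show ?thesis by blast
  qed
  moreover have "cis ` {a<..<b} \<subseteq> open_arc l r"
    unfolding open_arc_def image_subset_iff greaterThanLessThan_iff Ball_def
    using ab by blast
  ultimately show thesis using that ab by blast
qed

lemma open_arc_subset_circle: "open_arc l r \<subseteq> circle"
  by (auto simp: open_arc_def circle_def)

lemma move_point_in_arc:
  assumes "p \<in> open_arc l r" "q \<in> open_arc l r"
  obtains h where "orientation_preserving_homeo h" "h p = q"
    "\<And>z. z \<in> circle \<Longrightarrow> z \<notin> open_arc l r \<Longrightarrow> h z = z"
proof -
  obtain a b where ab: "a < b" "b < a + 2 * pi" and arc: "open_arc l r = cis ` {a<..<b}"
    using assms open_arc_eq_image_cis by blast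
  obtain x y where xy: "a < x" "x < b" "a < y" "y < b" "p = cis x" "q = cis y"
    using assms unfolding arc by auto
  have range: "bend a b x y t \<in> {a..<a + 2 * pi}"
    if "t \<in> {a..<a + 2 * pi}" "a < x" "x < b" "a < y" "y < b" for t x y
    using bend_bounds[OF that(2-5), of t] that ab
    by (cases "t \<le> a \<or> b \<le> t") (auto simp: bend_def)
  obtain g where g: "strict_mono g" "surj g" "\<And>t. g (t + 2 * pi) = g t + 2 * pi"
    "\<And>t. t \<in> {a..<a + 2 * pi} \<Longrightarrow> g t = bend a b x y t"
  \<comment> \<open>The bend with \<open>x\<close> and \<open>y\<close> exchanged provides the
    preimages, which is why \<open>range\<close> is stated for arbitrary \<open>x\<close> and
    \<open>y\<close>.\<close>
  proof (rule periodic_extension[of "bend a b x y" a "bend a b y x"])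
  qed (use xy range in \<open>auto simp: strict_mono_bend bend_inverse\<close>)
  obtain h where h: "orientation_preserving_homeo h" "\<And>t. h (cis t) = cis (g t)"
    using orientation_preserving_homeo_lift[OF g(1-3)] by blast
  have "h p = q" using xy ab by (simp add: h(2) g(4) bend_def)
  moreover have "h z = z" if z: "z \<in> circle" "z \<notin> open_arc l r" for z
  proof -
    obtain t where t: "z = cis t" using z by (auto simp: circle_eq_range_cis)
    \<comment> \<open>Lifting \<open>z\<close> to the period that starts at \<open>a\<close> turns
      lying outside the arc into lying outside the bent interval.\<close>
    define n where "n = \<lfloor>(t - a) / (2 * pi)\<rfloor>"
    define s where "s = t - 2 * pi * of_int n"
    have zs: "z = cis s" unfolding t s_def cis_eq_cis_iff by (rule exI[of _ n]) simp
    have "of_int n \<le> (t - a) / (2 * pi)" "(t - a) / (2 * pi) < of_int n + 1"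
      unfolding n_def by linarith+
    then have s: "s \<in> {a..<a + 2 * pi}"
      by (simp add: s_def pos_le_divide_eq pos_divide_less_eq algebra_simps)
    have "s \<notin> {a<..<b}" using z(2) unfolding arc zs by blast
    then have "bend a b x y s = s" by (auto simp: bend_def)
    then show ?thesis by (simp add: zs h(2) g(4)[OF s])
  qed
  ultimately show thesis using that h(1) by blast
qed

section \<open>Diagrams and their arrows\<close>

lemma map_arrow_sel [simp]:
  "tail (map_arrow h a) = h (tail a)" "head (map_arrow h a) = h (head a)"
  "sgn_of (map_arrow h a) = sgn_of a"
  by (simp_all add: map_arrow_def)

lemma map_arrow_id: "h (tail a) = tail a \<Longrightarrow> h (head a) = head a \<Longrightarrow> map_arrow h a = a"
  by (simp add: map_arrow_def)

lemma ends_map_arrow [simp]: "ends (map_arrow h a) = h ` ends a"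
  by (simp add: ends_def)

lemma endpoints_mono: "H \<subseteq> G \<Longrightarrow> endpoints H \<subseteq> endpoints G"
  by (auto simp: endpoints_def)

lemma tail_head_in_endpoints: "a \<in> G \<Longrightarrow> tail a \<in> endpoints G" "a \<in> G \<Longrightarrow> head a \<in> endpoints G"
  by (auto simp: endpoints_def ends_def)

lemma is_diagramD:
  assumes "is_diagram G"
  shows "finite G" "endpoints G \<subseteq> circle" "\<And>a. a \<in> G \<Longrightarrow> tail a \<noteq> head a"
    "\<And>a b. a \<in> G \<Longrightarrow> b \<in> G \<Longrightarrow> ends a \<inter> ends b \<noteq> {} \<Longrightarrow> a = b"
  using assms unfolding is_diagram_def endpoints_def by blast+

text \<open>No continuity is required of \<open>h\<close>, so that the lemma serves homeomorphisms
  and \<open>R3_swap\<close> alike.\<close>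

lemma is_diagram_map_arrow:
  assumes G: "is_diagram G" and h: "inj_on h circle" "h ` circle \<subseteq> circle"
  shows "is_diagram (map_arrow h ` G)"
  unfolding is_diagram_def
proof (intro conjI ballI impI)
  have ends: "ends a \<subseteq> circle" if "a \<in> G" for a
    using G that by (simp add: is_diagram_def)
  show "finite (map_arrow h ` G)" using is_diagramD(1)[OF G] by simp
  show "ends b \<subseteq> circle" if "b \<in> map_arrow h ` G" for b
    using that ends h(2) by fastforce
  show "tail b \<noteq> head b" if b: "b \<in> map_arrow h ` G" for b
  proof -
    obtain a where a: "a \<in> G" "b = map_arrow h a" using b by blast
    then have "tail a \<in> circle" "head a \<in> circle" using ends[OF a(1)] by (auto simp: ends_def)
    then show ?thesis using is_diagramD(3)[OF G a(1)] h(1) a(2) by (auto dest: inj_onD)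
  qed
  show "ends b \<inter> ends c = {}" if bc: "b \<in> map_arrow h ` G" "c \<in> map_arrow h ` G" "b \<noteq> c" for b c
  proof -
    obtain a a' where a: "a \<in> G" "b = map_arrow h a" "a' \<in> G" "c = map_arrow h a'" using bc by blast
    then have "ends a \<inter> ends a' = {}" using is_diagramD(4)[OF G, of a a'] bc(3) by blast
    then show ?thesis
      using inj_on_image_Int[OF h(1) ends[OF a(1)] ends[OF a(3)]] a by simp
  qed
qed

lemma orientation_preserving_homeo_bij:
  assumes "orientation_preserving_homeo h"
  shows "inj_on h circle" "h ` circle \<subseteq> circle"
proof -
  obtain h' where "homeomorphism circle circle h h'"
    using assms unfolding orientation_preserving_homeo_def by blast
  then show "inj_on h circle" "h ` circle \<subseteq> circle"
    by (auto simp: homeomorphism_def intro: inj_on_inverseI)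
qed

lemma inj_on_map_arrow:
  assumes "is_diagram G" "inj_on h circle"
  shows "inj_on (map_arrow h) G"
proof (rule inj_onI)
  fix a b assume ab: "a \<in> G" "b \<in> G" "map_arrow h a = map_arrow h b"
  then have "{tail a, head a, tail b, head b} \<subseteq> circle"
    using is_diagramD(2)[OF assms(1)] tail_head_in_endpoints by blast
  moreover have "h (tail a) = h (tail b)" "h (head a) = h (head b)" "sgn_of a = sgn_of b"
    using arg_cong[OF ab(3), of tail] arg_cong[OF ab(3), of head] arg_cong[OF ab(3), of sgn_of]
    by simp_all
  ultimately show "a = b" using assms(2) by (intro arrow.expand) (auto dest: inj_onD)
qed

lemma gauss_diagram_of_eqI: "same_diagram G H \<Longrightarrow> gauss_diagram_of G = gauss_diagram_of H"
  by (rule Quotient3_rel_abs[OF Quotient3_gauss_diagram])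

text \<open>Slide the tail inside its arc, then the head inside the other one. Disjointness of the
  arcs keeps the two motions from disturbing each other, and the endpoints of \<open>H\<close> lie
  outside both supports.\<close>

lemma same_diagram_move_arrow:
  assumes G: "is_diagram (insert a H)"
    and a: "tail a \<in> open_arc l r" "head a \<in> open_arc l' r'"
    and disj: "open_arc l r \<inter> open_arc l' r' = {}"
    and H: "open_arc l r \<inter> endpoints H = {}" "open_arc l' r' \<inter> endpoints H = {}"
    and pq: "p \<in> open_arc l r" "q \<in> open_arc l' r'"
  shows "same_diagram (insert a H) (insert (Arrow p q (sgn_of a)) H)"
proof -
  obtain h where h: "orientation_preserving_homeo h" "h (tail a) = p"
    "\<And>z. z \<in> circle \<Longrightarrow> z \<notin> open_arc l r \<Longrightarrow> h z = z"
    using move_point_in_arc[OF a(1) pq(1)] by blast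
  obtain k where k: "orientation_preserving_homeo k" "k (head a) = q"
    "\<And>z. z \<in> circle \<Longrightarrow> z \<notin> open_arc l' r' \<Longrightarrow> k z = z"
    using move_point_in_arc[OF a(2) pq(2)] by blast
  have kh: "orientation_preserving_homeo (k \<circ> h)"
    using h(1) k(1) by (rule orientation_preserving_homeo_compose)
  have "map_arrow (k \<circ> h) a = Arrow p q (sgn_of a)"
  proof -
    have "k p = p" using k(3)[of p] pq(1) disj open_arc_subset_circle by blast
    moreover have "h (head a) = head a" using h(3)[of "head a"] a(2) disj open_arc_subset_circle by blast
    ultimately show ?thesis by (simp add: map_arrow_def h(2) k(2))
  qed
  moreover have "map_arrow (k \<circ> h) b = b" if "b \<in> H" for b
  proof (rule map_arrow_id)
    have "endpoints H \<subseteq> circle"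
      using is_diagramD(2)[OF G] endpoints_mono[of H "insert a H"] by blast
    then have fixed: "(k \<circ> h) z = z" if "z \<in> endpoints H" for z
    proof -
      have "z \<in> circle" "z \<notin> open_arc l r" "z \<notin> open_arc l' r'"
        using that H \<open>endpoints H \<subseteq> circle\<close> by blast+
      then show ?thesis by (simp add: h(3) k(3))
    qed
    show "(k \<circ> h) (tail b) = tail b" "(k \<circ> h) (head b) = head b"
      by (intro fixed tail_head_in_endpoints that)+
  qed
  ultimately have "map_arrow (k \<circ> h) ` insert a H = insert (Arrow p q (sgn_of a)) H"
    by simp
  then show ?thesis
    unfolding same_diagram_def
    using G kh is_diagram_map_arrow[OF G orientation_preserving_homeo_bij[OF kh]] by metis
qed

section \<open>Moves on subdiagrams\<close>

text \<open>Deleting arrows cannot put endpoints on an empty arc. This is why the configuration of a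
  move survives in every subdiagram that contains its arrows.\<close>

lemma adjacent_subset:
  "adjacent G p q \<Longrightarrow> H \<subseteq> G \<Longrightarrow> p \<in> endpoints H \<Longrightarrow> q \<in> endpoints H \<Longrightarrow> adjacent H p q"
  unfolding adjacent_def using endpoints_mono[of H G] by blast

lemma R1_config_subset: "R1_config G a \<Longrightarrow> a \<in> H \<Longrightarrow> H \<subseteq> G \<Longrightarrow> R1_config H a"
  unfolding R1_config_def
  by (metis adjacent_subset is_diagram_subset tail_head_in_endpoints)

lemma R2_config_subset:
  "R2_config G a b \<Longrightarrow> a \<in> H \<Longrightarrow> b \<in> H \<Longrightarrow> H \<subseteq> G \<Longrightarrow> R2_config H a b"
  unfolding R2_config_def
  by (metis adjacent_subset is_diagram_subset tail_head_in_endpoints)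

lemma arc_meets_subset:
  "arc_meets G l r x y \<Longrightarrow> H \<subseteq> G \<Longrightarrow> x \<in> endpoints H \<Longrightarrow> y \<in> endpoints H \<Longrightarrow> arc_meets H l r x y"
  unfolding arc_meets_def using endpoints_mono[of H G] by blast

lemma R3_config_subset:
  assumes "R3_config G a12 a13 a23" "{a12, a13, a23} \<subseteq> H" "H \<subseteq> G"
  shows "R3_config H a12 a13 a23"
proof -
  have H: "a12 \<in> H" "a13 \<in> H" "a23 \<in> H" using assms(2) by auto
  have "arc_meets G l r x y \<Longrightarrow> x \<in> endpoints H \<Longrightarrow> y \<in> endpoints H \<Longrightarrow> arc_meets H l r x y" for l r x y
    using arc_meets_subset assms(3) by blast
  then show ?thesis
    using assms tail_head_in_endpoints[OF H(1)] tail_head_in_endpoints[OF H(2)]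
      tail_head_in_endpoints[OF H(3)]
    unfolding R3_config_def by (meson is_diagram_subset)
qed

section \<open>Endpoints in a third-move configuration\<close>

lemma arc_meetsD:
  assumes "arc_meets G l r x y"
  shows "x \<in> open_arc l r" "y \<in> open_arc l r" "x \<noteq> y"
proof -
  have "x \<noteq> y"
  proof
    \<comment> \<open>Two lifts of the same point would differ by a multiple of
      \<open>2 * pi\<close> strictly between 0 and \<open>2 * pi\<close>.\<close>
    assume "x = y"
    then obtain s t u where "s < t" "t < u" "u < s + 2 * pi" "cis t = cis s"
      using assms unfolding arc_meets_def open_arc_def by auto
    moreover from this obtain n :: int where n: "t = s + 2 * pi * of_int n"
      unfolding cis_eq_cis_iff by blast
    ultimately have "pi * 0 < pi * real_of_int n" "pi * real_of_int n < pi * 1"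
      by linarith+
    then have "0 < real_of_int n" "real_of_int n < 1"
      using pi_ge_zero mult_left_less_imp_less by blast+
    then show False by simp
  qed
  then show "x \<in> open_arc l r" "y \<in> open_arc l r" "x \<noteq> y"
    using assms unfolding arc_meets_def by auto
qed

lemma inj_R3_swap: "inj (R3_swap a12 a13 a23)"
  unfolding R3_swap_def by (intro inj_compose inj_transpose)

lemma R3_config_facts:
  assumes "R3_config G a12 a13 a23"
  shows "is_diagram G" "{a12, a13, a23} \<subseteq> G"
    and "distinct [tail a12, tail a13, head a12, tail a23, head a13, head a23]"
proof -
  obtain l1 r1 l2 r2 l3 r3 where
    disj: "open_arc l1 r1 \<inter> open_arc l2 r2 = {}" "open_arc l1 r1 \<inter> open_arc l3 r3 = {}"
      "open_arc l2 r2 \<inter> open_arc l3 r3 = {}" and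
    arcs: "arc_meets G l1 r1 (tail a12) (tail a13)" "arc_meets G l2 r2 (head a12) (tail a23)"
      "arc_meets G l3 r3 (head a13) (head a23)"
    using assms unfolding R3_config_def by blast
  show "distinct [tail a12, tail a13, head a12, tail a23, head a13, head a23]"
    using disj arcs[THEN arc_meetsD(1)] arcs[THEN arc_meetsD(2)] arcs[THEN arc_meetsD(3)] by auto
  show "is_diagram G" "{a12, a13, a23} \<subseteq> G"
    using assms by (auto simp: R3_config_def)
qed

text \<open>The six endpoints are distinct, so exactly one of the three transpositions moves each of
  them.\<close>

lemma R3_swap_apply:
  assumes "R3_config G a12 a13 a23"
  shows "map_arrow (R3_swap a12 a13 a23) a12 = Arrow (tail a13) (tail a23) (sgn_of a12)"
    "map_arrow (R3_swap a12 a13 a23) a13 = Arrow (tail a12) (head a23) (sgn_of a13)"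
    "map_arrow (R3_swap a12 a13 a23) a23 = Arrow (head a12) (head a13) (sgn_of a23)"
  using R3_config_facts(3)[OF assms]
  by (auto simp: map_arrow_def R3_swap_def Transposition.transpose_def)

lemma R3_swap_other:
  assumes "R3_config G a12 a13 a23" "b \<in> G - {a12, a13, a23}"
  shows "map_arrow (R3_swap a12 a13 a23) b = b"
proof -
  have "ends b \<inter> ends a = {}" if "a \<in> {a12, a13, a23}" for a
    using is_diagramD(4)[OF R3_config_facts(1)[OF assms(1)], of a b] R3_config_facts(2)[OF assms(1)]
      assms(2) that by blast
  from this[of a12] this[of a13] this[of a23] show ?thesis
    by (intro map_arrow_id) (auto simp: ends_def R3_swap_def Transposition.transpose_def)
qed

text \<open>If at most one of the three arrows is kept, each of the three arcs contains at most one
  endpoint, so the exchange of positions is achieved by sliding endpoints inside their arcs.\<close>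

lemma R3_swap_small:
  assumes R3: "R3_config G a12 a13 a23" and B: "B \<subseteq> G - {a12, a13, a23}"
    and S: "S \<subseteq> {a12, a13, a23}" "card S < 2"
  shows "gauss_diagram_of (map_arrow (R3_swap a12 a13 a23) ` (B \<union> S)) = gauss_diagram_of (B \<union> S)"
proof -
  obtain l1 r1 l2 r2 l3 r3 where
    disj: "open_arc l1 r1 \<inter> open_arc l2 r2 = {}" "open_arc l1 r1 \<inter> open_arc l3 r3 = {}"
      "open_arc l2 r2 \<inter> open_arc l3 r3 = {}" and
    arcs: "arc_meets G l1 r1 (tail a12) (tail a13)" "arc_meets G l2 r2 (head a12) (tail a23)"
      "arc_meets G l3 r3 (head a13) (head a23)"
    using R3 unfolding R3_config_def by blast
  have BG: "endpoints B \<subseteq> endpoints G" using B by (intro endpoints_mono) auto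
  have away: "endpoints B \<inter> ends a = {}" if "a \<in> {a12, a13, a23}" for a
    using is_diagramD(4)[OF R3_config_facts(1)[OF R3], of a] R3_config_facts(2)[OF R3] B that
    unfolding endpoints_def by blast
  \<comment> \<open>All endpoints on the arcs belong to the three arrows, and distinct arrows of a
    diagram share none.\<close>
  have empty: "open_arc l1 r1 \<inter> endpoints B = {}" "open_arc l2 r2 \<inter> endpoints B = {}"
    "open_arc l3 r3 \<inter> endpoints B = {}"
    using BG arcs away[of a12] away[of a13] away[of a23]
    unfolding arc_meets_def ends_def by blast+
  have B_fixed: "map_arrow (R3_swap a12 a13 a23) ` B = B"
    using B R3_swap_other[OF R3] by (force simp: image_iff)
  have diagram: "is_diagram (insert a B)" if "a \<in> {a12, a13, a23}" for a
    by (rule is_diagram_subset[OF R3_config_facts(1)[OF R3]])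
      (use that R3_config_facts(2)[OF R3] B in auto)
  note pts = arcs[THEN arc_meetsD(1)] arcs[THEN arc_meetsD(2)]
  have moved: "gauss_diagram_of (map_arrow (R3_swap a12 a13 a23) ` insert a B) = gauss_diagram_of (insert a B)"
    if "a \<in> {a12, a13, a23}" for a
  proof (rule gauss_diagram_of_eqI[symmetric])
    \<comment> \<open>Each arrow joins two of the arcs, and its ends slide to the other marked
      positions on these two arcs.\<close>
    have "a = a12 \<or> a = a13 \<or> a = a23" using that by blast
    then consider "a = a12" | "a = a13" | "a = a23" by blast
    then show "same_diagram (insert a B) (map_arrow (R3_swap a12 a13 a23) ` insert a B)"
    proof cases
      case 1
      with diagram[OF that] show ?thesis
        using same_diagram_move_arrow[OF _ pts(1,2) disj(1) empty(1,2) pts(4,5)]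
        by (simp add: B_fixed R3_swap_apply[OF R3])
    next
      case 2
      with diagram[OF that] show ?thesis
        using same_diagram_move_arrow[OF _ pts(4,3) disj(2) empty(1,3) pts(1,6)]
        by (simp add: B_fixed R3_swap_apply[OF R3])
    next
      case 3
      with diagram[OF that] show ?thesis
        using same_diagram_move_arrow[OF _ pts(5,6) disj(3) empty(2,3) pts(2,3)]
        by (simp add: B_fixed R3_swap_apply[OF R3])
    qed
  qed
  have "finite S" using S(1) by (rule finite_subset) simp
  have "S = {} \<or> (\<exists>a. S = {a})"
  proof (cases "card S = 0")
    case True then show ?thesis using \<open>finite S\<close> by simp
  next
    case False then show ?thesis using S(2) card_1_singletonE[of S] by (metis less_2_cases One_nat_def)
  qed
  then show ?thesis using S(1) B_fixed moved by auto
qed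

section \<open>Alternating sums over subdiagrams\<close>

text \<open>The sign is written as a case distinction because the values lie in an arbitrary abelian
  group, with no powers of -1 at hand.\<close>

definition alternating_sum :: "('a set \<Rightarrow> 'b::ab_group_add) \<Rightarrow> 'a set \<Rightarrow> 'b" where
  "alternating_sum g A = (\<Sum>H\<in>Pow A. if even (card (A - H)) then g H else - g H)"

lemma sum_Pow_insert:
  fixes f :: "'a set \<Rightarrow> 'b::comm_monoid_add"
  assumes "finite A" "a \<notin> A"
  shows "(\<Sum>H\<in>Pow (insert a A). f H) = (\<Sum>H\<in>Pow A. f (insert a H)) + (\<Sum>H\<in>Pow A. f H)"
proof -
  have "inj_on (insert a) (Pow A)"
    using assms(2) by (intro inj_onI) (auto simp: insert_ident)
  then have "(\<Sum>H\<in>insert a ` Pow A. f H) = (\<Sum>H\<in>Pow A. f (insert a H))"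
    by (simp add: sum.reindex)
  moreover have "(\<Sum>H\<in>Pow (insert a A). f H) = (\<Sum>H\<in>Pow A. f H) + (\<Sum>H\<in>insert a ` Pow A. f H)"
    unfolding Pow_insert using assms by (intro sum.union_disjoint) auto
  ultimately show ?thesis by (simp add: add.commute)
qed

lemma sum_Pow_union:
  fixes f :: "'a set \<Rightarrow> 'b::comm_monoid_add"
  assumes "finite A" "finite T" "A \<inter> T = {}"
  shows "(\<Sum>H\<in>Pow (A \<union> T). f H) = (\<Sum>H\<in>Pow A. \<Sum>S\<in>Pow T. f (H \<union> S))"
  using assms(2,3)
proof (induction T arbitrary: f rule: finite_induct)
  case (insert t T)
  then have "(\<Sum>H\<in>Pow (A \<union> insert t T). f H)
      = (\<Sum>H\<in>Pow (A \<union> T). f (insert t H)) + (\<Sum>H\<in>Pow (A \<union> T). f H)"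
    using assms(1) by (simp add: sum_Pow_insert)
  also have "\<dots> = (\<Sum>H\<in>Pow A. \<Sum>S\<in>Pow T. f (insert t (H \<union> S))) + (\<Sum>H\<in>Pow A. \<Sum>S\<in>Pow T. f (H \<union> S))"
    using insert by simp
  also have "\<dots> = (\<Sum>H\<in>Pow A. \<Sum>S\<in>Pow (insert t T). f (H \<union> S))"
    using insert by (simp add: sum_Pow_insert sum.distrib)
  finally show ?case .
qed simp

lemma alternating_sum_empty [simp]: "alternating_sum g {} = g {}"
  by (simp add: alternating_sum_def)

lemma alternating_sum_cong:
  "(\<And>H. H \<subseteq> A \<Longrightarrow> f H = g H) \<Longrightarrow> alternating_sum f A = alternating_sum g A"
  unfolding alternating_sum_def by (intro sum.cong) auto

text \<open>Adjoining an element acts as a difference operator: subsets with \<open>a\<close> keep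
  their complement, those without it have one more element in the complement and change
  sign.\<close>

lemma alternating_sum_insert:
  assumes "finite A" "a \<notin> A"
  shows "alternating_sum g (insert a A) = alternating_sum (\<lambda>H. g (insert a H)) A - alternating_sum g A"
proof -
  have "alternating_sum g (insert a A)
      = (\<Sum>H\<in>Pow A. if even (card (insert a A - insert a H)) then g (insert a H) else - g (insert a H))
        + (\<Sum>H\<in>Pow A. if even (card (insert a A - H)) then g H else - g H)"
    unfolding alternating_sum_def by (rule sum_Pow_insert[OF assms])
  also have "(\<Sum>H\<in>Pow A. if even (card (insert a A - insert a H)) then g (insert a H) else - g (insert a H))
      = alternating_sum (\<lambda>H. g (insert a H)) A"
    using assms(2) unfolding alternating_sum_def by (simp add: insert_Diff_if)
  also have "(\<Sum>H\<in>Pow A. if even (card (insert a A - H)) then g H else - g H) = - alternating_sum g A"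
    unfolding alternating_sum_def sum_negf[symmetric]
  proof (rule sum.cong[OF refl])
    fix H assume "H \<in> Pow A"
    then have "insert a A - H = insert a (A - H)" using assms(2) by auto
    then show "(if even (card (insert a A - H)) then g H else - g H)
        = - (if even (card (A - H)) then g H else - g H)"
      using assms by simp
  qed
  finally show ?thesis by simp
qed

lemma alternating_sum_image:
  assumes "inj_on f A"
  shows "alternating_sum g (f ` A) = alternating_sum (\<lambda>H. g (f ` H)) A"
proof -
  have "Pow (f ` A) = (`) f ` Pow A" by (simp add: image_Pow_surj)
  moreover have "card (f ` A - f ` H) = card (A - H)" if "H \<in> Pow A" for H
  proof -
    have "f ` A - f ` H = f ` (A - H)" using inj_on_image_set_diff[OF assms, of A H] that by auto
    then show ?thesis using assms by (simp add: card_image inj_on_diff)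
  qed
  ultimately show ?thesis
    unfolding alternating_sum_def by (simp add: sum.reindex[OF inj_on_image_Pow[OF assms]])
qed

text \<open>Summing over the subsets of \<open>T\<close> is inverse to the alternating summation over them.\<close>

lemma sum_alternating_sum:
  assumes "finite B" "finite T" "B \<inter> T = {}"
  shows "(\<Sum>S\<in>Pow T. alternating_sum g (B \<union> S)) = alternating_sum (\<lambda>H. g (H \<union> T)) B"
  using assms(2,3)
proof (induction T arbitrary: g rule: finite_induct)
  case (insert t T)
  have "alternating_sum g (B \<union> insert t S)
      = alternating_sum (\<lambda>H. g (insert t H)) (B \<union> S) - alternating_sum g (B \<union> S)" if "S \<in> Pow T" for S
  proof -
    have "finite (B \<union> S)" using that insert.hyps(1) assms(1) by (auto dest: finite_subset)
    moreover have "t \<notin> B \<union> S" using that insert by auto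
    ultimately show ?thesis by (simp add: alternating_sum_insert)
  qed
  \<comment> \<open>The subtracted half of each difference cancels against the subsets without
    \<open>t\<close>. What remains is the same sum for the shifted function, hence the induction
    over arbitrary \<open>g\<close>.\<close>
  then have "(\<Sum>S\<in>Pow (insert t T). alternating_sum g (B \<union> S))
      = (\<Sum>S\<in>Pow T. alternating_sum (\<lambda>H. g (insert t H)) (B \<union> S))"
    using insert.hyps by (simp add: sum_Pow_insert sum_subtractf)
  then show ?case using insert by simp
qed simp

section \<open>The Polyak relations\<close>

lemma polyak_relations_subgroup: "subgroup polyak_relations arrow_diagram_group"
  unfolding polyak_relations_def
  by (rule group.generate_is_subgroup) auto

lemma polyak_relations_zero: "0 \<in> polyak_relations"
  using subgroup.one_closed[OF polyak_relations_subgroup] by simp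

lemma polyak_relations_add: "x \<in> polyak_relations \<Longrightarrow> y \<in> polyak_relations \<Longrightarrow> x + y \<in> polyak_relations"
  using subgroup.m_closed[OF polyak_relations_subgroup] by simp

lemma polyak_relations_minus: "x \<in> polyak_relations \<Longrightarrow> - x \<in> polyak_relations"
  using subgroup.m_inv_closed[OF polyak_relations_subgroup] by simp

lemma polyak_relations_sum:
  "(\<And>i. i \<in> X \<Longrightarrow> f i \<in> polyak_relations) \<Longrightarrow> sum f X \<in> polyak_relations"
  by (induction X rule: infinite_finite_induct)
    (auto intro: polyak_relations_zero polyak_relations_add)

lemma polyak_class_eq_iff: "polyak_class x = polyak_class y \<longleftrightarrow> x - y \<in> polyak_relations"
proof
  assume "polyak_class x = polyak_class y"
  moreover have "x \<in> polyak_class x"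
    using polyak_relations_zero by (force simp: polyak_class_def r_coset_def)
  ultimately show "x - y \<in> polyak_relations"
    by (auto simp: polyak_class_def r_coset_def)
next
  assume xy: "x - y \<in> polyak_relations"
  have "polyak_class x \<subseteq> polyak_class y" if "x - y \<in> polyak_relations" for x y
  proof
    fix z assume "z \<in> polyak_class x"
    then obtain h where "h \<in> polyak_relations" "z = h + x"
      by (auto simp: polyak_class_def r_coset_def)
    then have "h + (x - y) \<in> polyak_relations" "z = (h + (x - y)) + y"
      using that by (auto intro: polyak_relations_add)
    then show "z \<in> polyak_class y"
      unfolding polyak_class_def r_coset_def by force
  qed
  from this[OF xy] this[of y x] show "polyak_class x = polyak_class y"
    using polyak_relations_minus[OF xy] by auto
qed

lemma polyak_class_in_carrier: "polyak_class x \<in> carrier polyak_algebra"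
  by (auto simp: polyak_class_def polyak_algebra_def FactGroup_def RCOSETS_def)

section \<open>Invariance of the sum of subdiagrams modulo the relations\<close>

lemma subdiagram_sum_gauss_diagram_of:
  "is_diagram G \<Longrightarrow> subdiagram_sum (gauss_diagram_of G) = (\<Sum>H\<in>Pow G. frag_of (gauss_diagram_of H))"
  by (rule subdiagram_sum.abs_eq) (rule same_diagram_refl)

text \<open>Links the truncated sums of the third relation with the full sums that come from
  subdiagrams and from Moebius inversion.\<close>

lemma sum_large_subsets:
  fixes f :: "'a set \<Rightarrow> 'b::comm_monoid_add"
  assumes "finite T" "\<And>S. S \<subseteq> T \<Longrightarrow> card S < 2 \<Longrightarrow> f S = 0"
  shows "(\<Sum>S | S \<subseteq> T \<and> 2 \<le> card S. f S) = (\<Sum>S\<in>Pow T. f S)"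
proof (rule sum.mono_neutral_left)
  show "\<forall>S\<in>Pow T - {S. S \<subseteq> T \<and> 2 \<le> card S}. f S = 0"
    using assms(2) by (simp add: not_le)
qed (use assms(1) in auto)

lemma R3_swap_is_diagram:
  assumes "R3_config G a12 a13 a23"
  shows "is_diagram (map_arrow (R3_swap a12 a13 a23) ` G)"
proof (rule is_diagram_map_arrow)
  show G: "is_diagram G" by (rule R3_config_facts[OF assms])
  show "inj_on (R3_swap a12 a13 a23) circle"
    using inj_R3_swap by (rule inj_on_subset) auto
  have "{a12, a13, a23} \<subseteq> G" by (rule R3_config_facts[OF assms])
  then have "{tail a12, tail a13, head a12, tail a23, head a13, head a23} \<subseteq> circle"
    using is_diagramD(2)[OF G] tail_head_in_endpoints by blast
  moreover have "Transposition.transpose p q z \<in> circle"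
    if "p \<in> circle" "q \<in> circle" "z \<in> circle" for p q z
    using that by (simp add: Transposition.transpose_def)
  ultimately show "R3_swap a12 a13 a23 ` circle \<subseteq> circle"
    by (simp add: R3_swap_def image_subset_iff)
qed

lemma subdiagram_sum_move:
  assumes "reidemeister_move D D'"
  shows "subdiagram_sum D - subdiagram_sum D' \<in> polyak_relations"
  using assms
proof cases
  case (R1 G a)
  define B where "B = G - {a}"
  have G: "is_diagram G" "a \<in> G" using R1(3) by (auto simp: R1_config_def)
  then have B: "G = insert a B" "a \<notin> B" "finite B" "is_diagram B"
    by (auto simp: B_def is_diagramD(1) intro: is_diagram_subset)
  \<comment> \<open>The subdiagrams without \<open>a\<close> are those of the smaller diagram and
    cancel.\<close>
  have "subdiagram_sum D - subdiagram_sum D' = (\<Sum>H\<in>Pow B. frag_of (gauss_diagram_of (insert a H)))"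
    using R1(1,2) G(1) B by (simp add: subdiagram_sum_gauss_diagram_of sum_Pow_insert)
  also have "\<dots> \<in> polyak_relations"
  proof (rule polyak_relations_sum)
    fix H assume "H \<in> Pow B"
    then have "R1_config (insert a H) a" using B(1) by (intro R1_config_subset[OF R1(3)]) auto
    then show "frag_of (gauss_diagram_of (insert a H)) \<in> polyak_relations"
      unfolding polyak_relations_def by (intro generate.incl polyak_relators.rel1)
  qed
  finally show ?thesis .
next
  case (R2 G a b)
  define B where "B = G - {a, b}"
  have G: "is_diagram G" "a \<in> G" "b \<in> G" "a \<noteq> b" using R2(3) by (auto simp: R2_config_def)
  then have B: "G = insert a (insert b B)" "a \<notin> B" "b \<notin> B" "finite B" "is_diagram B"
    by (auto simp: B_def is_diagramD(1) intro: is_diagram_subset)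
  have "D' = gauss_diagram_of B" using R2(2) by (simp add: B_def)
  then have "subdiagram_sum D - subdiagram_sum D' =
      (\<Sum>H\<in>Pow B. frag_of (gauss_diagram_of (insert a (insert b H)))
        + frag_of (gauss_diagram_of (insert a H)) + frag_of (gauss_diagram_of (insert b H)))"
    using R2(1) G B
    by (simp add: subdiagram_sum_gauss_diagram_of sum_Pow_insert sum.distrib algebra_simps)
  also have "\<dots> \<in> polyak_relations"
  proof (rule polyak_relations_sum)
    fix H assume H: "H \<in> Pow B"
    let ?A = "insert a (insert b H)"
    have "R2_config ?A a b" using H B(1) by (intro R2_config_subset[OF R2(3)]) auto
    then have "frag_of (gauss_diagram_of ?A) + frag_of (gauss_diagram_of (?A - {b}))
        + frag_of (gauss_diagram_of (?A - {a})) \<in> polyak_relations"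
      unfolding polyak_relations_def by (intro generate.incl polyak_relators.rel2)
    moreover have "?A - {b} = insert a H" "?A - {a} = insert b H" using H G(4) B(2,3) by auto
    ultimately show "frag_of (gauss_diagram_of ?A) + frag_of (gauss_diagram_of (insert a H))
        + frag_of (gauss_diagram_of (insert b H)) \<in> polyak_relations" by simp
  qed
  finally show ?thesis .
next
  case (R3 G a12 a13 a23)
  let ?s = "map_arrow (R3_swap a12 a13 a23)"
  define T where "T = {a12, a13, a23}"
  define B where "B = G - T"
  define d where "d H = frag_of (gauss_diagram_of H) - frag_of (gauss_diagram_of (?s ` H))" for H
  have G: "is_diagram G" "T \<subseteq> G" using R3_config_facts[OF R3(3)] by (auto simp: T_def)
  then have B: "G = B \<union> T" "B \<inter> T = {}" "finite B" "finite T"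
    by (auto simp: B_def T_def is_diagramD(1))
  \<comment> \<open>By injectivity the subdiagrams of the new diagram are the images of those of the
    old one, so the two sums can be subtracted term by term.\<close>
  have "inj_on ?s G"
    by (rule inj_on_map_arrow[OF G(1) inj_on_subset[OF inj_R3_swap]]) simp
  then have "subdiagram_sum D' = (\<Sum>H\<in>Pow G. frag_of (gauss_diagram_of (?s ` H)))"
    unfolding R3(2) subdiagram_sum_gauss_diagram_of[OF R3_swap_is_diagram[OF R3(3)]]
    by (simp add: sum.reindex[OF inj_on_image_Pow] flip: image_Pow_surj[OF refl])
  then have "subdiagram_sum D - subdiagram_sum D' = (\<Sum>H\<in>Pow G. d H)"
    unfolding R3(1) subdiagram_sum_gauss_diagram_of[OF G(1)] by (simp add: d_def sum_subtractf)
  also have "\<dots> = (\<Sum>H\<in>Pow B. \<Sum>S\<in>Pow T. d (H \<union> S))"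
    unfolding B(1) by (rule sum_Pow_union) (use B in auto)
  also have "\<dots> \<in> polyak_relations"
  proof (rule polyak_relations_sum)
    fix H assume "H \<in> Pow B"
    then have H: "H \<subseteq> G - {a12, a13, a23}" by (auto simp: B_def T_def)
    have conf: "R3_config (H \<union> T) a12 a13 a23"
      using H G(2) by (intro R3_config_subset[OF R3(3)]) (auto simp: T_def)
    have "(\<Sum>S | S \<subseteq> T \<and> 2 \<le> card S. frag_of (gauss_diagram_of (H \<union> T - (T - S))))
        - (\<Sum>S | S \<subseteq> T \<and> 2 \<le> card S. frag_of (gauss_diagram_of (?s ` (H \<union> T - (T - S)))))
        \<in> polyak_relations"
      unfolding polyak_relations_def
      by (intro generate.incl polyak_relators.rel3 conf) (simp add: T_def)
    also have "(\<Sum>S | S \<subseteq> T \<and> 2 \<le> card S. frag_of (gauss_diagram_of (H \<union> T - (T - S))))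
        - (\<Sum>S | S \<subseteq> T \<and> 2 \<le> card S. frag_of (gauss_diagram_of (?s ` (H \<union> T - (T - S)))))
        = (\<Sum>S | S \<subseteq> T \<and> 2 \<le> card S. d (H \<union> S))"
      unfolding sum_subtractf[symmetric]
    proof (rule sum.cong[OF refl])
      fix S assume "S \<in> {S. S \<subseteq> T \<and> 2 \<le> card S}"
      then have "H \<union> T - (T - S) = H \<union> S" using H by (auto simp: T_def)
      then show "frag_of (gauss_diagram_of (H \<union> T - (T - S)))
          - frag_of (gauss_diagram_of (?s ` (H \<union> T - (T - S)))) = d (H \<union> S)"
        by (simp add: d_def)
    qed
    \<comment> \<open>Subsets with at most one arrow contribute nothing, since both diagrams then
      have the same class.\<close>
    also have "\<dots> = (\<Sum>S\<in>Pow T. d (H \<union> S))"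
    proof (rule sum_large_subsets[OF B(4)])
      show "d (H \<union> S) = 0" if "S \<subseteq> T" "card S < 2" for S
        using R3_swap_small[OF R3(3) H that[unfolded T_def]] by (simp add: d_def)
    qed
    finally show "(\<Sum>S\<in>Pow T. d (H \<union> S)) \<in> polyak_relations" .
  qed
  finally show ?thesis .
qed

section \<open>Recovering the knot\<close>

definition knot_of :: "arrow set \<Rightarrow> virtual_knot \<Rightarrow>\<^sub>0 int" where
  "knot_of G = frag_of (virtual_knot_of (gauss_diagram_of G))"

lemma knot_of_move:
  "reidemeister_move (gauss_diagram_of G) (gauss_diagram_of H) \<Longrightarrow> knot_of G = knot_of H"
  unfolding knot_of_def
  by (rule arg_cong[where f = frag_of]) (rule virtual_knot.abs_eq_iff[THEN iffD2, OF r_into_equivclp])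

text \<open>A homeomorphism matches the subsets of two representatives, preserving the sizes of
  complements, and matched subsets give the same Gauss diagram.\<close>

lift_definition knot_combination :: "arrow_diagram \<Rightarrow> virtual_knot \<Rightarrow>\<^sub>0 int" is
  "alternating_sum knot_of"
proof -
  fix G K assume "same_diagram G K"
  then obtain h where h: "is_diagram G" "is_diagram K" "orientation_preserving_homeo h"
    "K = map_arrow h ` G" unfolding same_diagram_def by blast
  have "gauss_diagram_of (map_arrow h ` H) = gauss_diagram_of H" if "H \<subseteq> G" for H
  proof (rule gauss_diagram_of_eqI[symmetric])
    have "map_arrow h ` H \<subseteq> K" using that h(4) by blast
    then show "same_diagram H (map_arrow h ` H)"
      unfolding same_diagram_def using that h is_diagram_subset by blast
  qed
  then have "alternating_sum knot_of G = alternating_sum (\<lambda>H. knot_of (map_arrow h ` H)) G"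
    by (intro alternating_sum_cong) (simp add: knot_of_def)
  also have "\<dots> = alternating_sum knot_of K"
    unfolding h(4)
    by (intro alternating_sum_image[symmetric] inj_on_map_arrow h(1) orientation_preserving_homeo_bij h(3))
  finally show "alternating_sum knot_of G = alternating_sum knot_of K" .
qed

lemma knot_combination_gauss_diagram_of:
  "is_diagram G \<Longrightarrow> knot_combination (gauss_diagram_of G) = alternating_sum knot_of G"
  by (rule knot_combination.abs_eq) (rule same_diagram_refl)

text \<open>In each relation the alternating sums combine so that the arrows of the move occur
  either all together or not at all. The move can then be applied to each remaining term.\<close>

lemma knot_combination_relator:
  assumes "x \<in> polyak_relators"
  shows "frag_extend knot_combination x = 0"
  using assms
proof cases
  case (rel1 A a)
  define B where "B = A - {a}"
  have A: "is_diagram A" "a \<in> A" using rel1(2) by (auto simp: R1_config_def)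
  then have B: "A = insert a B" "a \<notin> B" "finite B"
    by (auto simp: B_def is_diagramD(1))
  have "knot_of (insert a H) = knot_of H" if "H \<subseteq> B" for H
  proof -
    have "R1_config (insert a H) a" using that B(1) by (intro R1_config_subset[OF rel1(2)]) auto
    moreover have "insert a H - {a} = H" using that B(2) by auto
    ultimately show ?thesis using reidemeister_move.R1 knot_of_move by metis
  qed
  then have "alternating_sum (\<lambda>H. knot_of (insert a H)) B = alternating_sum knot_of B"
    by (rule alternating_sum_cong)
  moreover have "frag_extend knot_combination x
      = alternating_sum (\<lambda>H. knot_of (insert a H)) B - alternating_sum knot_of B"
    unfolding rel1(1) frag_extend_of knot_combination_gauss_diagram_of[OF A(1)]
    unfolding B(1) by (rule alternating_sum_insert[OF B(3,2)])
  ultimately show ?thesis by simp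
next
  case (rel2 A a b)
  define B where "B = A - {a, b}"
  have A: "is_diagram A" "a \<in> A" "b \<in> A" "a \<noteq> b" using rel2(2) by (auto simp: R2_config_def)
  then have B: "A = insert a (insert b B)" "a \<notin> B" "b \<notin> B" "finite B"
      "A - {b} = insert a B" "A - {a} = insert b B"
    by (auto simp: B_def is_diagramD(1))
  have "knot_of (insert a (insert b H)) = knot_of H" if "H \<subseteq> B" for H
  proof -
    have "R2_config (insert a (insert b H)) a b"
      using that B(1) by (intro R2_config_subset[OF rel2(2)]) auto
    moreover have "insert a (insert b H) - {a, b} = H" using that B(2,3) by auto
    ultimately show ?thesis using reidemeister_move.R2 knot_of_move by metis
  qed
  then have "alternating_sum (\<lambda>H. knot_of (insert a (insert b H))) B = alternating_sum knot_of B"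
    by (rule alternating_sum_cong)
  moreover have "frag_extend knot_combination x = alternating_sum knot_of A
      + alternating_sum knot_of (insert a B) + alternating_sum knot_of (insert b B)"
    unfolding rel2(1) frag_extend_add frag_extend_of B(5,6)
    using A(1) is_diagram_subset[OF A(1), of "insert a B"] is_diagram_subset[OF A(1), of "insert b B"]
    by (simp add: knot_combination_gauss_diagram_of B(1) subset_insertI2)
  \<comment> \<open>Of the four sums, the two with exactly one of \<open>a\<close>, \<open>b\<close>
    are cancelled by the other terms of the relator; those with both and with neither agree by the
    second move.\<close>
  moreover have "alternating_sum knot_of A =
      alternating_sum (\<lambda>H. knot_of (insert a (insert b H))) B - alternating_sum (\<lambda>H. knot_of (insert a H)) B
      - (alternating_sum (\<lambda>H. knot_of (insert b H)) B - alternating_sum knot_of B)"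
    unfolding B(1) using B(2-4) A(4) by (simp add: alternating_sum_insert)
  ultimately show ?thesis using B(2-4) by (simp add: alternating_sum_insert)
next
  case (rel3 A a12 a13 a23 T)
  let ?s = "map_arrow (R3_swap a12 a13 a23)"
  define B where "B = A - T"
  define d where "d H = knot_combination (gauss_diagram_of H)
    - knot_combination (gauss_diagram_of (?s ` H))" for H
  have A: "is_diagram A" "T \<subseteq> A" using R3_config_facts[OF rel3(2)] rel3(3) by auto
  then have B: "A = B \<union> T" "B \<inter> T = {}" "finite B" "finite T"
    by (auto simp: B_def rel3(3) is_diagramD(1))
  have fin: "finite {S. S \<subseteq> T \<and> 2 \<le> card S}" using B(4) by simp
  have "A - (T - S) = B \<union> S" if "S \<subseteq> T" for S using that B(1,2) by auto
  then have "frag_extend knot_combination x = (\<Sum>S | S \<subseteq> T \<and> 2 \<le> card S. d (B \<union> S))"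
    unfolding rel3(1) frag_extend_diff frag_extend_sum[OF fin]
    unfolding sum_subtractf[symmetric]
    by (intro sum.cong) (auto simp: d_def)
  also have "\<dots> = (\<Sum>S\<in>Pow T. d (B \<union> S))"
  proof (rule sum_large_subsets[OF B(4)])
    show "d (B \<union> S) = 0" if "S \<subseteq> T" "card S < 2" for S
      using R3_swap_small[OF rel3(2), of B S] that by (simp add: d_def B_def rel3(3))
  qed
  also have "\<dots> = (\<Sum>S\<in>Pow T. alternating_sum knot_of (B \<union> S)
      - alternating_sum (\<lambda>H. knot_of (?s ` H)) (B \<union> S))"
  proof (rule sum.cong[OF refl])
    fix S assume "S \<in> Pow T"
    then have BS: "B \<union> S \<subseteq> A" using B(1) by auto
    then have "is_diagram (?s ` (B \<union> S))"
      by (intro is_diagram_subset[OF R3_swap_is_diagram[OF rel3(2)]]) auto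
    moreover have "inj_on ?s (B \<union> S)"
      by (rule inj_on_map_arrow[OF is_diagram_subset[OF A(1) BS] inj_on_subset[OF inj_R3_swap]]) simp
    ultimately show "d (B \<union> S) = alternating_sum knot_of (B \<union> S)
        - alternating_sum (\<lambda>H. knot_of (?s ` H)) (B \<union> S)"
      using is_diagram_subset[OF A(1) BS]
      by (simp only: d_def knot_combination_gauss_diagram_of alternating_sum_image)
  qed
  \<comment> \<open>The truncated sum would not collapse; completed to all of \<open>Pow T\<close>,
    it leaves only subdiagrams with all three arrows.\<close>
  also have "\<dots> = alternating_sum (\<lambda>H. knot_of (H \<union> T)) B - alternating_sum (\<lambda>H. knot_of (?s ` (H \<union> T))) B"
    unfolding sum_subtractf by (simp only: sum_alternating_sum[OF B(3,4,2)])
  also have "alternating_sum (\<lambda>H. knot_of (H \<union> T)) B = alternating_sum (\<lambda>H. knot_of (?s ` (H \<union> T))) B"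
  proof (rule alternating_sum_cong)
    fix H assume "H \<subseteq> B"
    then have "R3_config (H \<union> T) a12 a13 a23"
      using B(1) by (intro R3_config_subset[OF rel3(2)]) (auto simp: rel3(3))
    then show "knot_of (H \<union> T) = knot_of (?s ` (H \<union> T))"
      by (intro knot_of_move reidemeister_move.R3)
  qed
  finally show ?thesis by simp
qed

lemma knot_combination_relations:
  assumes "x \<in> polyak_relations"
  shows "frag_extend knot_combination x = 0"
  using assms unfolding polyak_relations_def
  by (induction rule: generate.induct)
    (simp_all add: knot_combination_relator frag_extend_add frag_extend_minus)

section \<open>Inversion of the sum over subdiagrams\<close>

lemma gauss_diagram_cases:
  obtains G where "is_diagram G" "D = gauss_diagram_of G"
proof -
  have "same_diagram (rep_gauss_diagram D) (rep_gauss_diagram D)"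
    by (rule Quotient3_rep_reflp[OF Quotient3_gauss_diagram])
  moreover have "D = gauss_diagram_of (rep_gauss_diagram D)"
    by (simp add: Quotient3_abs_rep[OF Quotient3_gauss_diagram])
  ultimately show thesis using that unfolding same_diagram_def by blast
qed

lemma knot_combination_subdiagram_sum:
  "frag_extend knot_combination (subdiagram_sum D) = frag_of (virtual_knot_of D)"
proof -
  obtain G where G: "is_diagram G" "D = gauss_diagram_of G" by (rule gauss_diagram_cases)
  have "frag_extend knot_combination (subdiagram_sum D)
      = (\<Sum>H\<in>Pow G. knot_combination (gauss_diagram_of H))"
    using is_diagramD(1)[OF G(1)]
    by (simp add: G subdiagram_sum_gauss_diagram_of frag_extend_sum)
  \<comment> \<open>The empty base reduces the sum to the inversion formula, in which only the whole
    diagram \<open>G\<close> survives.\<close>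
  also have "\<dots> = (\<Sum>H\<in>Pow G. alternating_sum knot_of ({} \<union> H))"
    using is_diagram_subset[OF G(1)] by (intro sum.cong) (auto simp: knot_combination_gauss_diagram_of)
  also have "\<dots> = knot_of G"
    using is_diagramD(1)[OF G(1)] by (subst sum_alternating_sum) auto
  finally show ?thesis by (simp add: G(2) knot_of_def)
qed

theorem theorem2p4:
  shows "\<exists>f :: virtual_knot \<Rightarrow> (arrow_diagram \<Rightarrow>\<^sub>0 int) set.
    f \<in> UNIV \<rightarrow> carrier polyak_algebra \<and>
    (\<forall>D :: gauss_diagram. f (virtual_knot_of D) = polyak_class (I_map (frag_of D))) \<and>
    inj f"
proof -
  \<comment> \<open>One direction makes the invariant independent of the diagram, the other makes it
    injective.\<close>
  have class_eq: "polyak_class (subdiagram_sum D) = polyak_class (subdiagram_sum D') \<longleftrightarrow>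
      virtual_knot_of D = virtual_knot_of D'" for D D'
  proof
    assume "polyak_class (subdiagram_sum D) = polyak_class (subdiagram_sum D')"
    then have "frag_extend knot_combination (subdiagram_sum D - subdiagram_sum D') = 0"
      unfolding polyak_class_eq_iff by (rule knot_combination_relations)
    then show "virtual_knot_of D = virtual_knot_of D'"
      by (simp add: frag_extend_diff knot_combination_subdiagram_sum frag_of_eq)
  next
    assume "virtual_knot_of D = virtual_knot_of D'"
    \<comment> \<open>Equivalent diagrams are joined by a chain of moves in either direction, and
      equality of classes is symmetric and transitive.\<close>
    then have "equivclp reidemeister_move D D'" by (simp add: virtual_knot.abs_eq_iff)
    then show "polyak_class (subdiagram_sum D) = polyak_class (subdiagram_sum D')"
      by induction (use subdiagram_sum_move polyak_class_eq_iff in \<open>metis+\<close>)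
  qed
  define f where "f K = polyak_class (subdiagram_sum (rep_virtual_knot K))" for K
  have rep: "virtual_knot_of (rep_virtual_knot K) = K" for K
    by (rule Quotient3_abs_rep[OF Quotient3_virtual_knot])
  have "f (virtual_knot_of D) = polyak_class (I_map (frag_of D))" for D
    by (simp add: f_def I_map_def class_eq rep)
  moreover have "inj f"
    by (rule injI) (metis f_def class_eq rep)
  moreover have "f \<in> UNIV \<rightarrow> carrier polyak_algebra"
    by (simp add: f_def polyak_class_in_carrier)
  ultimately show ?thesis by blast
qed

end
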